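(* Let $X=\{x_1,\dots,x_n\}\subset\mathbb{R}^m$ be a data set whose $m$ coordinates are called features, and let $V=\{1,\dots,m\}$. For a clustering $\mathcal{C}=\{C_1,\dots,C_k\}$ of $X$ with centroids $Z=\{z_1,\dots,z_k\}$, let $\varphi_u$ denote the Shapley value of feature $u\in V$ in the cooperative game with player set $V$ and characteristic function $$f(S)=\sum_{\ell=1}^k\sum_{x_i\in C_\ell}\sum_{v\in S}(x_{iv}-z_{\ell v})^2,\qquad S\subseteq V.$$ Then the $k$-means algorithm iteratively minimises the sum of the Shapley values over all features, $\sum_{u=1}^m\varphi_u$.
   Context: A clustering $\mathcal{C}=\{C_1,\dots,C_k\}$ of $X$ is a partition of $X$ into $k$ clusters, and $z_\ell\in\mathbb{R}^m$ is the centroid of $C_\ell$; $x_{iv}$ and $z_{\ell v}$ denote the $v$-th coordinates of $x_i$ and $z_\ell$. For $f:2^V\to\mathbb{R}$ with $V=\{1,\dots,m\}$, the Shapley value of $u\in V$ is $$\varphi_u=\sum_{S\subseteq V\setminus\{u\}}\frac{|S|!\,(m-|S|-1)!}{m!}\bigl[f(S\cup\{u\})-f(S)\bigr].$$ The $k$-means algorithm alternates between assigning every point of $X$ to the cluster of its nearest centroid (in Euclidean distance) and replacing every centroid by the component-wise mean of the points in its cluster, until convergence; it iteratively minimises the objective $$W(\mathcal{C},Z)=\sum_{\ell=1}^{k}\sum_{x_i\in C_\ell}\sum_{v=1}^m (x_{iv}-z_{\ell v})^2.$$ *)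

theory Defs
  imports "HOL-Analysis.Analysis"
begin

definition shapley :: "'p set \<Rightarrow> ('p set \<Rightarrow> real) \<Rightarrow> 'p \<Rightarrow> real" where
  "shapley V f u =
    (\<Sum>S\<in>Pow (V - {u}).
       fact (card S) * fact (card V - card S - 1) / fact (card V) * (f (S \<union> {u}) - f S))"

(* Clusters are indexed by {1..k}, since each cluster is paired with its centroid. A block may be
   empty, because an assignment step of k-means can empty a cluster; the families with nonempty
   blocks are exactly the (labelled) partitions of X into k clusters. *)
definition clustering :: "'a set \<Rightarrow> nat \<Rightarrow> (nat \<Rightarrow> 'a set) \<Rightarrow> bool" where
  "clustering X k C \<longleftrightarrow> disjoint_family_on C {1..k} \<and> (\<Union>l\<in>{1..k}. C l) = X"

definition feature_game ::
  "nat \<Rightarrow> (nat \<Rightarrow> (real ^ 'm) set) \<Rightarrow> (nat \<Rightarrow> real ^ 'm) \<Rightarrow> 'm set \<Rightarrow> real" where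
  "feature_game k C Z S = (\<Sum>l=1..k. \<Sum>x\<in>C l. \<Sum>v\<in>S. (x $ v - Z l $ v)\<^sup>2)"

definition kmeans_objective ::
  "nat \<Rightarrow> (nat \<Rightarrow> (real ^ 'm) set) \<Rightarrow> (nat \<Rightarrow> real ^ 'm) \<Rightarrow> real" where
  "kmeans_objective k C Z = (\<Sum>l=1..k. \<Sum>x\<in>C l. \<Sum>v\<in>UNIV. (x $ v - Z l $ v)\<^sup>2)"

definition shapley_total ::
  "nat \<Rightarrow> (nat \<Rightarrow> (real ^ 'm) set) \<Rightarrow> (nat \<Rightarrow> real ^ 'm) \<Rightarrow> real" where
  "shapley_total k C Z = (\<Sum>u\<in>UNIV. shapley UNIV (feature_game k C Z) u)"

(* Ties between nearest centroids may be broken in any way. *)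
definition assignment_step ::
  "(real ^ 'm) set \<Rightarrow> nat \<Rightarrow> (nat \<Rightarrow> real ^ 'm) \<Rightarrow> (nat \<Rightarrow> (real ^ 'm) set) \<Rightarrow> bool" where
  "assignment_step X k Z C \<longleftrightarrow>
    clustering X k C \<and> (\<forall>l\<in>{1..k}. \<forall>x\<in>C l. \<forall>j\<in>{1..k}. dist x (Z l) \<le> dist x (Z j))"

(* The mean of an empty cluster is undefined; such a cluster keeps its centroid. *)
definition update_step ::
  "nat \<Rightarrow> (nat \<Rightarrow> (real ^ 'm) set) \<Rightarrow> (nat \<Rightarrow> real ^ 'm) \<Rightarrow> (nat \<Rightarrow> real ^ 'm) \<Rightarrow> bool" where
  "update_step k C Z Z' \<longleftrightarrow>
    (\<forall>l\<in>{1..k}. Z' l =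
       (if C l = {} then Z l else (\<chi> v. (\<Sum>x\<in>C l. x $ v) / real (card (C l)))))"

(* The first T iterations from arbitrary initial centroids Z 0: C t assigns the points to the
   centroids Z t, and Z (Suc t) consists of the means of C t. T is arbitrary, so this includes the
   runs that are stopped once the centroids no longer change. *)
definition kmeans_run ::
  "(real ^ 'm) set \<Rightarrow> nat \<Rightarrow> nat \<Rightarrow> (nat \<Rightarrow> nat \<Rightarrow> (real ^ 'm) set) \<Rightarrow>
    (nat \<Rightarrow> nat \<Rightarrow> real ^ 'm) \<Rightarrow> bool" where
  "kmeans_run X k T C Z \<longleftrightarrow>
    (\<forall>t<T. assignment_step X k (Z t) (C t) \<and> update_step k (C t) (Z t) (Z (Suc t)))"

(* Alternating minimisation of F: each half-step is an exact minimisation in one of the two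
   arguments, the other one being fixed, and F does not increase along the iterates. *)
definition iteratively_minimises ::
  "(real ^ 'm) set \<Rightarrow> nat \<Rightarrow> nat \<Rightarrow> (nat \<Rightarrow> nat \<Rightarrow> (real ^ 'm) set) \<Rightarrow>
    (nat \<Rightarrow> nat \<Rightarrow> real ^ 'm) \<Rightarrow>
    ((nat \<Rightarrow> (real ^ 'm) set) \<Rightarrow> (nat \<Rightarrow> real ^ 'm) \<Rightarrow> real) \<Rightarrow> bool" where
  "iteratively_minimises X k T C Z F \<longleftrightarrow>
    (\<forall>t<T. is_arg_min (\<lambda>C'. F C' (Z t)) (clustering X k) (C t)
         \<and> is_arg_min (\<lambda>Z'. F (C t) Z') (\<lambda>_. True) (Z (Suc t)))
    \<and> (\<forall>t. Suc t < T \<longrightarrow> F (C (Suc t)) (Z (Suc t)) \<le> F (C t) (Z t))"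

end

theory Submission
  imports Defs
begin

text \<open>
  The characteristic function is additive over features, and the Shapley weights of the coalitions
  avoiding \<open>u\<close> add up to one, so the Shapley value of \<open>u\<close> is the contribution of the single
  feature \<open>u\<close> and the sum of these values is the k-means objective. An assignment step minimises
  each point's term separately, and a mean minimises the sum of squared deviations, so every
  half-step is an exact minimisation; monotonicity along a run is two such half-steps in a row.
\<close>

text \<open>A Shapley weight depends on the coalition only through its size, so the sum over
  coalitions can be grouped by cardinality.\<close>

lemma sum_Pow_card:
  fixes h :: "nat \<Rightarrow> real"
  assumes "finite A"
  shows "(\<Sum>S\<in>Pow A. h (card S)) = (\<Sum>s\<le>card A. real (card A choose s) * h s)"
proof -
  have "(\<Sum>S\<in>Pow A. h (card S)) = (\<Sum>s\<le>card A. \<Sum>S\<in>{S \<in> Pow A. card S = s}. h (card S))"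
    using assms by (intro sum.group [symmetric]) (auto intro: card_mono)
  also have "\<dots> = (\<Sum>s\<le>card A. real (card {S. S \<subseteq> A \<and> card S = s}) * h s)"
    by (intro sum.cong) (auto simp: Pow_def)
  finally show ?thesis
    using assms by (simp add: n_subsets)
qed

lemma sum_shapley_weights:
  assumes "finite V" "u \<in> V"
  shows "(\<Sum>S\<in>Pow (V - {u}). fact (card S) * fact (card V - card S - 1) / fact (card V)) = (1::real)"
proof -
  obtain n where n: "card V = Suc n"
    using assms by (metis card_Suc_Diff1)
  then have card: "card (V - {u}) = n"
    using assms by simp
  have "(\<Sum>S\<in>Pow (V - {u}). fact (card S) * fact (card V - card S - 1) / fact (card V)) =
      (\<Sum>s\<le>n. real (n choose s) * (fact s * fact (n - s) / fact (Suc n)))"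
    using sum_Pow_card [of "V - {u}" "\<lambda>s. fact s * fact (n - s) / fact (Suc n)"] assms card n
    by simp
  \<comment> \<open>The binomial coefficient cancels the factorials, so each of the
    \<open>Suc n\<close> coalition sizes carries the same total weight.\<close>
  also have "\<dots> = (\<Sum>s\<le>n. 1 / real (Suc n))"
  proof (intro sum.cong refl)
    fix s assume "s \<in> {..n}"
    then have "real (n choose s) * (fact s * fact (n - s)) = fact n"
      using binomial_fact [of s n, where 'a = real] by (simp add: field_simps)
    then show "real (n choose s) * (fact s * fact (n - s) / fact (Suc n)) = 1 / real (Suc n)"
      by (simp only: times_divide_eq_right fact_Suc) simp
  qed
  also have "\<dots> = 1"
    by simp
  finally show ?thesis .
qed

text \<open>The marginal contribution of \<open>u\<close> is \<open>g u\<close> whatever coalition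
  it joins, and the weights average this constant.\<close>

lemma shapley_additive:
  assumes "finite V" "u \<in> V"
  shows "shapley V (sum g) u = g u"
proof -
  have "sum g (S \<union> {u}) - sum g S = g u" if "S \<in> Pow (V - {u})" for S
    using that assms by (subst sum.union_disjoint) (auto intro: finite_subset)
  then have "shapley V (sum g) u =
      (\<Sum>S\<in>Pow (V - {u}). fact (card S) * fact (card V - card S - 1) / fact (card V)) * g u"
    unfolding shapley_def sum_distrib_right by (intro sum.cong) auto
  then show ?thesis
    using sum_shapley_weights [OF assms] by simp
qed

text \<open>An equation of functions, with \<open>sum\<close> lacking its set argument, brings the
  game into the form \<open>sum g\<close> of \<open>shapley_additive\<close>.\<close>

lemma feature_game_additive:
  "feature_game k C Z = sum (\<lambda>v. \<Sum>l=1..k. \<Sum>x\<in>C l. (x $ v - Z l $ v)\<^sup>2)"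
proof
  fix S
  have "(\<Sum>x\<in>C l. \<Sum>v\<in>S. (x $ v - Z l $ v)\<^sup>2) = (\<Sum>v\<in>S. \<Sum>x\<in>C l. (x $ v - Z l $ v)\<^sup>2)" for l
    by (rule sum.swap)
  then show "feature_game k C Z S = (\<Sum>v\<in>S. \<Sum>l=1..k. \<Sum>x\<in>C l. (x $ v - Z l $ v)\<^sup>2)"
    unfolding feature_game_def by (simp add: sum.swap [of _ S])
qed

lemma shapley_total_eq_kmeans_objective: "shapley_total k C Z = kmeans_objective k C Z"
proof -
  have "shapley_total k C Z = feature_game k C Z UNIV"
    unfolding shapley_total_def by (simp add: feature_game_additive shapley_additive)
  then show ?thesis
    by (simp add: feature_game_def kmeans_objective_def)
qed

lemma kmeans_objective_dist:
  "kmeans_objective k C Z = (\<Sum>l=1..k. \<Sum>x\<in>C l. (dist x (Z l))\<^sup>2)"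
  by (simp add: kmeans_objective_def dist_vec_def L2_set_def dist_real_def sum_nonneg)

lemma finite_cluster:
  assumes "finite X" "clustering X k C" "l \<in> {1..k}"
  shows "finite (C l)"
  using assms by (auto simp: clustering_def intro: finite_subset)

lemma sum_clustering:
  fixes g :: "'a \<Rightarrow> real"
  assumes "finite X" "clustering X k C"
  shows "(\<Sum>l=1..k. \<Sum>x\<in>C l. g x) = sum g X"
proof -
  have "sum g (\<Union>l\<in>{1..k}. C l) = (\<Sum>l=1..k. \<Sum>x\<in>C l. g x)"
    using assms finite_cluster [OF assms]
    by (intro sum.UNION_disjoint) (auto simp: clustering_def disjoint_family_on_def)
  then show ?thesis
    using assms by (simp add: clustering_def)
qed

lemma assignment_step_minimal:
  assumes "finite X" "assignment_step X k Z C" "clustering X k C'"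
  shows "kmeans_objective k C Z \<le> kmeans_objective k C' Z"
proof -
  \<comment> \<open>The squared distance to the nearest centroid does not depend on the clustering:
    it bounds every point's term from below, and an assignment step attains it.\<close>
  define g where "g x = Min ((\<lambda>j. (dist x (Z j))\<^sup>2) ` {1..k})" for x
  have C: "clustering X k C"
    using assms(2) by (simp add: assignment_step_def)
  have "g x = (dist x (Z l))\<^sup>2" if "l \<in> {1..k}" "x \<in> C l" for l x
    unfolding g_def using that assms(2)
    by (intro Min_eqI) (auto simp: assignment_step_def intro!: power_mono)
  then have "kmeans_objective k C Z = (\<Sum>l=1..k. \<Sum>x\<in>C l. g x)"
    unfolding kmeans_objective_dist by (intro sum.cong) auto
  also have "\<dots> = (\<Sum>l=1..k. \<Sum>x\<in>C' l. g x)"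
    using sum_clustering [OF assms(1) C] sum_clustering [OF assms(1,3)] by simp
  also have "\<dots> \<le> kmeans_objective k C' Z"
    unfolding kmeans_objective_dist g_def by (intro sum_mono Min_le) auto
  finally show ?thesis .
qed

text \<open>Replacing the mean by \<open>c\<close> adds \<open>card A\<close> times the squared
  distance between them. If \<open>A\<close> is empty or infinite, both sums are 0.\<close>

lemma sum_squared_deviations_mean_le:
  fixes f :: "'a \<Rightarrow> real"
  shows "(\<Sum>x\<in>A. (f x - sum f A / real (card A))\<^sup>2) \<le> (\<Sum>x\<in>A. (f x - c)\<^sup>2)"
proof (cases "finite A \<and> A \<noteq> {}")
  case True
  define \<mu> where "\<mu> = sum f A / real (card A)"
  have sum: "sum f A = real (card A) * \<mu>"
    using True by (simp add: \<mu>_def)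
  \<comment> \<open>The correction term is affine in \<open>f x\<close>, so its sum involves
    \<open>f\<close> only through \<open>sum f A\<close>.\<close>
  have "(\<Sum>x\<in>A. (f x - c)\<^sup>2) = (\<Sum>x\<in>A. (f x - \<mu>)\<^sup>2 + (2 * (\<mu> - c) * f x + (c\<^sup>2 - \<mu>\<^sup>2)))"
    by (intro sum.cong) (auto simp: power2_eq_square algebra_simps)
  also have "\<dots> = (\<Sum>x\<in>A. (f x - \<mu>)\<^sup>2) + (2 * (\<mu> - c) * sum f A + real (card A) * (c\<^sup>2 - \<mu>\<^sup>2))"
    by (simp add: sum.distrib sum_distrib_left)
  also have "2 * (\<mu> - c) * sum f A + real (card A) * (c\<^sup>2 - \<mu>\<^sup>2) = real (card A) * (\<mu> - c)\<^sup>2"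
    unfolding sum by (simp add: power2_eq_square algebra_simps)
  finally show ?thesis
    by (simp add: \<mu>_def)
qed auto

text \<open>Clusters and coordinates decouple into one-dimensional problems solved by the mean; an
  empty cluster contributes 0 for any centroid.\<close>

lemma update_step_minimal:
  assumes "update_step k C Z Z'"
  shows "kmeans_objective k C Z' \<le> kmeans_objective k C W"
  unfolding kmeans_objective_def
proof (rule sum_mono)
  fix l assume l: "l \<in> {1..k}"
  have "(\<Sum>x\<in>C l. (x $ v - Z' l $ v)\<^sup>2) \<le> (\<Sum>x\<in>C l. (x $ v - W l $ v)\<^sup>2)" for v
    using assms l sum_squared_deviations_mean_le [of "\<lambda>x. x $ v" "C l" "W l $ v"]
    by (cases "C l = {}") (auto simp: update_step_def)
  then show "(\<Sum>x\<in>C l. \<Sum>v\<in>UNIV. (x $ v - Z' l $ v)\<^sup>2) \<le> (\<Sum>x\<in>C l. \<Sum>v\<in>UNIV. (x $ v - W l $ v)\<^sup>2)"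
    by (simp add: sum.swap [of _ UNIV] sum_mono)
qed

lemma kmeans_run_iteratively_minimises:
  assumes "finite X" and run: "kmeans_run X k T C Z"
  shows "iteratively_minimises X k T C Z (kmeans_objective k)"
proof -
  have clustering: "clustering X k (C t)"
    and assignment: "clustering X k C' \<Longrightarrow> kmeans_objective k (C t) (Z t) \<le> kmeans_objective k C' (Z t)"
    and update: "kmeans_objective k (C t) (Z (Suc t)) \<le> kmeans_objective k (C t) W"
    if "t < T" for t C' W
    using run that assignment_step_minimal [OF assms(1)] update_step_minimal
    unfolding kmeans_run_def assignment_step_def by blast+
  have "kmeans_objective k (C (Suc t)) (Z (Suc t)) \<le> kmeans_objective k (C t) (Z t)"
    if "Suc t < T" for t
    \<comment> \<open>At \<open>Z (Suc t)\<close> the old clustering \<open>C t\<close> is the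
      competitor; for \<open>C t\<close> the old centroids \<open>Z t\<close> are.\<close>
    using assignment [OF that clustering, of t] update [of t "Z t"] that by simp
  then show ?thesis
    using clustering assignment update
    by (auto simp: iteratively_minimises_def is_arg_min_def not_less)
qed

theorem theorem1:
  fixes X :: "(real ^ 'm) set" and k :: nat
  assumes "finite X"
  shows "(\<forall>C Z. clustering X k C \<longrightarrow> shapley_total k C Z = kmeans_objective k C Z)
    \<and> (\<forall>T C Z. kmeans_run X k T C Z \<longrightarrow> iteratively_minimises X k T C Z (shapley_total k))"
proof -
  \<comment> \<open>Equality as functions is needed because \<open>iteratively_minimises\<close>
    takes the objective unapplied.\<close>
  have "shapley_total k = (kmeans_objective k :: _ \<Rightarrow> (nat \<Rightarrow> real ^ 'm) \<Rightarrow> real)"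
    by (intro ext shapley_total_eq_kmeans_objective)
  then show ?thesis
    using kmeans_run_iteratively_minimises [OF assms] by simp
qed

end
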